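(* For all integers $n\ge1$ and $s\ge0$, $$k(s,n)\le\left\lceil\frac{2s}{n+1}\right\rceil+1.$$ Equivalently, for all $n\ge1$, $k\ge1$, the size $s$ of the minimal universal testing set over $\mathbb{Q}$ for tropical polynomials in $n$ variables with at most $k$ monomials satisfies $$s\ge\frac{(k-1)(n+1)+1}{2}.$$
   Context: A tropical polynomial over $\mathbb{Q}$ in $\vec{x}=(x_1,\dots,x_n)$ is a finite collection of tropical monomials $m_J(\vec{x}) = c_J + j_1x_1+\dots+j_nx_n$ with pairwise distinct exponent vectors $J=(j_1,\dots,j_n)$ and constants $c_J\in\mathbb{Q}$; its value is $p(\vec{x})=\max_J m_J(\vec{x})$. Here the exponents are allowed to be arbitrary rational numbers (this does not affect the quantities below compared with nonnegative integer exponents). A polynomial is nontrivial if it has at least one monomial. A point $\vec{a}\in\mathbb{Q}^n$ is a root of $p$ if the maximum $\max_J m_J(\vec{a})$ is attained on at least two distinct monomials; otherwise it is a non-root. $k(s,n)$ denotes the minimal number such that for any set $S$ of $s$ points in $\mathbb{Q}^n$ there is a nontrivial tropical polynomial over $\mathbb{Q}$ in $n$ variables with at most $k(s,n)$ monomials having roots in all the points of $S$. A universal testing set over $\mathbb{Q}$ for tropical polynomials of $n$ variables with at most $k$ monomials is a finite set $S\subseteq\mathbb{Q}^n$ such that every nontrivial tropical polynomial over $\mathbb{Q}$ in $n$ variables with at most $k$ monomials has a non-root in $S$. *)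

theory Defs
  imports "HOL-Analysis.Analysis"
begin

text \<open>
  Points of \<open>\<rat>\<^sup>n\<close> are elements of \<^typ>\<open>rat ^ 'n\<close> with \<open>n = CARD('n) \<ge> 1\<close>.
  A tropical monomial is a pair of its exponent vector and its constant; exponents range over
  all rationals.
\<close>

type_synonym 'n trop_monomial = "(rat ^ 'n) \<times> rat"

definition trop_monomial_eval :: "'n::finite trop_monomial \<Rightarrow> rat ^ 'n \<Rightarrow> rat" where
  "trop_monomial_eval m x = snd m + (\<Sum>i\<in>UNIV. fst m $ i * x $ i)"

text \<open>
  Injectivity of \<^const>\<open>fst\<close> says that distinct monomials have distinct exponent vectors, so
  \<^term>\<open>card p\<close> counts the monomials.
\<close>

definition trop_poly :: "'n::finite trop_monomial set \<Rightarrow> bool" where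
  "trop_poly p \<longleftrightarrow> finite p \<and> inj_on fst p"

text \<open>Meaningful for nontrivial polynomials only: \<^const>\<open>Max\<close> is unspecified on the empty set.\<close>

definition trop_eval :: "'n::finite trop_monomial set \<Rightarrow> rat ^ 'n \<Rightarrow> rat" where
  "trop_eval p x = Max ((\<lambda>m. trop_monomial_eval m x) ` p)"

definition trop_root :: "'n::finite trop_monomial set \<Rightarrow> rat ^ 'n \<Rightarrow> bool" where
  "trop_root p a \<longleftrightarrow>
    (\<exists>m\<in>p. \<exists>m'\<in>p. m \<noteq> m' \<and>
      trop_monomial_eval m a = trop_eval p a \<and> trop_monomial_eval m' a = trop_eval p a)"

text \<open>\<open>k(s, n)\<close>, with the dimension \<open>n = CARD('n)\<close> passed as a type.\<close>

definition min_monomials :: "'n::finite itself \<Rightarrow> nat \<Rightarrow> nat" where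
  "min_monomials _ s =
    (LEAST k. \<forall>S :: (rat ^ 'n) set. finite S \<and> card S = s \<longrightarrow>
      (\<exists>p. trop_poly p \<and> p \<noteq> {} \<and> card p \<le> k \<and> (\<forall>a\<in>S. trop_root p a)))"

definition universal_testing_set :: "nat \<Rightarrow> (rat ^ 'n::finite) set \<Rightarrow> bool" where
  "universal_testing_set k S \<longleftrightarrow>
    finite S \<and>
    (\<forall>p. trop_poly p \<and> p \<noteq> {} \<and> card p \<le> k \<longrightarrow> (\<exists>a\<in>S. \<not> trop_root p a))"

text \<open>
  Testing sets exist for every \<open>k\<close>: the roots of a polynomial with at most \<open>k\<close> monomials lie on at
  most \<open>k choose 2\<close> hyperplanes, so any set of more than \<open>n * (k choose 2)\<close> points of which no
  \<open>n + 1\<close> lie on a common hyperplane is one. Hence the minimum below is attained.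
\<close>

definition min_testing_set_size :: "'n::finite itself \<Rightarrow> nat \<Rightarrow> nat" where
  "min_testing_set_size _ k =
    (LEAST s. \<exists>S :: (rat ^ 'n) set. universal_testing_set k S \<and> card S = s)"

end

theory Submission
  imports Defs "HOL-Computational_Algebra.Polynomial"
begin

text \<open>
  Write \<open>n = CARD('n)\<close>. A polynomial vanishing on a given finite set is assembled from the inside of
  the set to its outside. Suppose that some polynomial has roots on an inner part \<open>R\<close> of the set and
  that its monomial \<open>M\<close> is maximal on the next layer \<open>A\<close>. Let \<open>g\<close> be an affine function that is \<open>0\<close>
  on \<open>A\<close>, nonpositive on \<open>R\<close> and positive on the layer \<open>T\<close> after \<open>A\<close>. Then the new monomial
  \<open>M + l * g\<close> with large \<open>l\<close> ties with \<open>M\<close> on \<open>A\<close>, does not disturb the maximum on \<open>R\<close>, and is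
  maximal on \<open>T\<close>, so the construction can go on with \<open>T\<close> (\<open>extend_outwards\<close>). Each layer thus costs
  a single monomial, and \<open>g\<close> has to control the sign on the next layer only: the layers further out
  are irrelevant because later coefficients are chosen much larger.

  It remains to peel layers off a finite set from the outside such that two consecutive layers
  contain at least \<open>n + 1\<close> points together. Two kinds of layers alternate. If an affine function
  separates \<open>T\<close> from the remaining points, one of them is a vertex \<open>p\<close> of their convex hull at which a
  supporting hyperplane separates \<open>T\<close> from all points but \<open>p\<close> (\<open>peel_vertex\<close>). From the single
  point \<open>p\<close>, some facet of the convex hull of the other points is visible, and a facet contains at
  least \<open>n\<close> of them (\<open>visible_facet\<close>). The facet may fail to exist only if \<open>p\<close> and all remaining points
  lie on one hyperplane; then two monomials that tie on this hyperplane deal with all of them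
  (\<open>extendable_hyperplane\<close>). Hence \<open>c\<close> layers suffice for any \<open>c * (n + 1) / 2\<close> points, if the
  outermost layer is a facet when \<open>c\<close> is odd, and this gives both bounds.

  The bound on testing sets also requires that a testing set exists, since otherwise the minimal
  size would be an arbitrary number. Sufficiently many points on the moment curve form one, as the
  roots of a polynomial with \<open>k\<close> monomials lie on at most \<open>k\<^sup>2\<close> hyperplanes.
\<close>

section \<open>Affine functions\<close>

text \<open>
  A pair of a vector and a constant also serves as an affine function; it is nonconstant iff its
  first component is nonzero.
\<close>

abbreviation ev :: "'n::finite trop_monomial \<Rightarrow> rat ^ 'n \<Rightarrow> rat" where
  "ev \<equiv> trop_monomial_eval"

definition scale :: "rat \<Rightarrow> 'n::finite trop_monomial \<Rightarrow> 'n trop_monomial" where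
  "scale l g = (l *s fst g, l * snd g)"

lemma ev_add [simp]: "ev (f + g) x = ev f x + ev g x"
  by (simp add: trop_monomial_eval_def sum.distrib algebra_simps)

lemma ev_scale [simp]: "ev (scale l g) x = l * ev g x"
  by (simp add: trop_monomial_eval_def scale_def sum_distrib_left algebra_simps)

lemma ev_const [simp]: "ev (0, c) x = c"
  by (simp add: trop_monomial_eval_def)

lemma ev_constant: "fst g = 0 \<Longrightarrow> ev g x = ev g y"
  by (simp add: trop_monomial_eval_def)

lemma ex_multiple_dominating:
  fixes b c :: "'a \<Rightarrow> rat"
  assumes "finite A" and pos: "\<And>a. a \<in> A \<Longrightarrow> b a > 0"
  shows "\<exists>L. \<forall>l\<ge>L. \<forall>a\<in>A. c a < l * b a"
proof -
  obtain L where L: "\<forall>y\<in>(\<lambda>a. c a / b a) ` A. y < L"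
    using finite_imageI[OF \<open>finite A\<close>, of "\<lambda>a. c a / b a"]
    by (metis Max_ge gt_ex le_less_trans)
  have "c a < l * b a" if "l \<ge> L" "a \<in> A" for l a
  proof -
    have "c a / b a < l" using L that by (meson imageI less_le_trans)
    with pos[OF \<open>a \<in> A\<close>] show ?thesis by (simp add: divide_less_eq)
  qed
  then show ?thesis by blast
qed

text \<open>
  Any at most \<open>n\<close> points lie on a common hyperplane. Let the rows of a square matrix be the
  differences of all points from one of them. That row is zero, so the matrix is singular, and a
  nonzero vector in its kernel is a normal vector of the hyperplane.
\<close>

lemma ex_affine_vanishing:
  fixes X :: "(rat ^ 'n::finite) set"
  assumes "finite X" and "card X \<le> CARD('n)"
  shows "\<exists>u. fst u \<noteq> 0 \<and> (\<forall>x\<in>X. ev u x = 0)"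
proof -
  obtain h :: "rat ^ 'n \<Rightarrow> 'n" where h: "inj_on h X"
    using card_le_inj[of X "UNIV :: 'n set"] assms by auto
  \<comment> \<open>Indices outside the range of \<open>h\<close> stand for arbitrary further points, which do no harm.\<close>
  define r where "r = inv_into X h"
  fix i0 :: 'n
  define A :: "rat ^ 'n ^ 'n" where "A = (\<chi> i. r i - r i0)"
  have "(A *v a) $ i0 = 0" for a
    by (simp add: A_def matrix_vector_mult_def)
  then have "\<not> surj ((*v) A)"
    by (metis surjD one_index zero_neq_one)
  then have "\<not> inj ((*v) A)"
    using vec.linear_injective_imp_surjective matrix_vector_mul_linear_gen by blast
  then obtain v w where vw: "v \<noteq> w" "A *v v = A *v w"
    by (auto simp: inj_def)
  define a where "a = v - w"
  have a: "a \<noteq> 0" "A *v a = 0"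
    using vw by (auto simp: a_def matrix_vector_mult_diff_distrib)
  define u where "u = (a, - (\<Sum>j\<in>UNIV. a $ j * r i0 $ j))"
  have "ev u x = 0" if "x \<in> X" for x
  proof -
    have x: "x = r (h x)" using h that by (simp add: r_def)
    have "(A *v a) $ h x = 0" using a by simp
    then have "(\<Sum>j\<in>UNIV. (r (h x) $ j - r i0 $ j) * a $ j) = 0"
      by (simp add: A_def matrix_vector_mult_def)
    then show ?thesis
      unfolding u_def trop_monomial_eval_def x[symmetric]
      by (simp add: algebra_simps sum_subtractf)
  qed
  with a show ?thesis by (intro exI[of _ u]) (auto simp: u_def)
qed

section \<open>Peeling vertices and facets off a finite set\<close>

text \<open>
  A point far away from \<open>S\<close> plays the part of the outer layer from which the peeling of \<open>S\<close> starts.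
\<close>

lemma ex_point_beyond:
  fixes S :: "(rat ^ 'n::finite) set"
  assumes "finite S"
  shows "\<exists>p f. ev f p = 0 \<and> (\<forall>x\<in>S. ev f x < 0)"
proof -
  obtain c :: rat where c: "\<forall>x\<in>S. (\<Sum>i\<in>UNIV. x $ i) < c * rat_of_nat CARD('n)"
    using ex_multiple_dominating[OF assms, of "\<lambda>_. rat_of_nat CARD('n)" "\<lambda>x. \<Sum>i\<in>UNIV. x $ i"] by auto
  show ?thesis
    using c
    by (intro exI[of _ "\<chi> i. c"] exI[of _ "(1, - (c * rat_of_nat CARD('n)))"])
       (simp add: trop_monomial_eval_def)
qed

text \<open>
  A maximizer of \<open>g\<close> on \<open>R\<close> need not be unique. Adding the strictly convex function
  \<open>x \<mapsto> \<parallel>x\<parallel>\<^sup>2\<close> to a large multiple of \<open>g\<close> breaks the ties: linearizing the square at a maximizer \<open>p\<close> of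
  the sum gives an affine function that has its only maximum on \<open>R\<close> at \<open>p\<close>, and if the multiple is
  large enough, \<open>T\<close> remains beyond the level of \<open>p\<close>.
\<close>

lemma peel_vertex:
  fixes R T :: "(rat ^ 'n::finite) set"
  assumes "finite R" "finite T" "R \<noteq> {}"
    and gT: "\<And>x. x \<in> T \<Longrightarrow> ev g x = 0" and gR: "\<And>x. x \<in> R \<Longrightarrow> ev g x < 0"
  shows "\<exists>p\<in>R. \<exists>f. ev f p = 0 \<and> (\<forall>x\<in>R - {p}. ev f x < 0) \<and> (\<forall>x\<in>T. ev f x > 0)"
proof -
  define dot :: "rat ^ 'n \<Rightarrow> rat ^ 'n \<Rightarrow> rat" where "dot x y = (\<Sum>i\<in>UNIV. x $ i * y $ i)" for x y
  have dot_ev: "ev (y, - dot y y) x = dot y x - dot y y" for x y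
    by (simp add: trop_monomial_eval_def dot_def)
  have square: "2 * dot y x < dot x x + dot y y" if neq: "x \<noteq> y" for x y
  proof -
    have "dot x x + dot y y - 2 * dot y x = (\<Sum>i\<in>UNIV. (x $ i - y $ i)\<^sup>2)"
      by (simp add: dot_def power2_eq_square algebra_simps sum.distrib sum_subtractf sum_distrib_left)
    moreover obtain i where "x $ i \<noteq> y $ i" using neq by (auto simp: vec_eq_iff)
    then have "(\<Sum>i\<in>UNIV. (x $ i - y $ i)\<^sup>2) > 0"
      by (intro sum_pos2[of _ i]) auto
    ultimately show ?thesis by linarith
  qed
  \<comment> \<open>The multiple must be fixed before \<open>p\<close> is known, so it has to work for every \<open>y \<in> R\<close>.\<close>
  have "\<exists>L. \<forall>l\<ge>L. \<forall>z\<in>T \<times> R.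
      2 * (dot (snd z) (snd z) - dot (snd z) (fst z)) < l * (- ev g (snd z))"
    by (rule ex_multiple_dominating) (use assms in auto)
  then obtain K where K: "\<And>x y. x \<in> T \<Longrightarrow> y \<in> R \<Longrightarrow> 2 * (dot y y - dot y x) < K * (- ev g y)"
    by (metis SigmaI fst_conv snd_conv order_refl)
  let ?\<phi> = "\<lambda>x. K * ev g x + dot x x"
  have fin: "finite (?\<phi> ` R)" using \<open>finite R\<close> by simp
  then have "Max (?\<phi> ` R) \<in> ?\<phi> ` R" using \<open>R \<noteq> {}\<close> by (intro Max_in) auto
  then obtain p where p: "p \<in> R" "Max (?\<phi> ` R) = ?\<phi> p" by blast
  have pmax: "?\<phi> x \<le> ?\<phi> p" if "x \<in> R" for x
    unfolding p(2)[symmetric] using fin that by (intro Max_ge) auto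
  define f where "f = scale K (g + (0, - ev g p)) + scale 2 (p, - dot p p)"
  have f: "ev f x = K * (ev g x - ev g p) + 2 * (dot p x - dot p p)" for x
    by (simp add: f_def dot_ev)
  have "ev f x < 0" if "x \<in> R - {p}" for x
    using square[of x p] pmax[of x] that by (simp add: f algebra_simps)
  moreover have "ev f x > 0" if "x \<in> T" for x
    using K[OF that p(1)] gT[OF that] by (simp add: f algebra_simps)
  ultimately show ?thesis
    using p by (intro bexI[of _ p] exI[of _ f]) (auto simp: f)
qed

text \<open>
  The affine functions that are \<open>1\<close> at \<open>p\<close> and nonpositive on \<open>Q\<close> form a nonempty polyhedron, and a
  vertex of it is tight at many points of \<open>Q\<close>. Such a vertex is found by maximizing the number of
  tight points. If there are fewer than \<open>n\<close>, some nonconstant affine function vanishes at all of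
  them and at \<open>p\<close>; moving along it until the next inequality becomes tight contradicts maximality.
\<close>

lemma visible_facet:
  fixes Q :: "(rat ^ 'n::finite) set"
  assumes "finite Q" and fp: "ev f p = 0" and fQ: "\<And>x. x \<in> Q \<Longrightarrow> ev f x < 0"
    and spanning: "\<And>u. fst u \<noteq> 0 \<Longrightarrow> \<exists>x\<in>insert p Q. ev u x \<noteq> 0"
  shows "\<exists>g. ev g p > 0 \<and> (\<forall>x\<in>Q. ev g x \<le> 0) \<and> CARD('n) \<le> card {x\<in>Q. ev g x = 0}"
proof -
  define feasible where "feasible g \<longleftrightarrow> ev g p = 1 \<and> (\<forall>x\<in>Q. ev g x \<le> 0)" for g
  define tight where "tight g = {x\<in>Q. ev g x = 0}" for g
  have finite_tight: "finite (tight g)" for g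
    using \<open>finite Q\<close> by (simp add: tight_def)
  obtain L where L: "\<forall>x\<in>Q. 1 < L * (- ev f x)"
    using ex_multiple_dominating[OF \<open>finite Q\<close>, of "\<lambda>x. - ev f x" "\<lambda>_. 1"] fQ by fastforce
  have "feasible (scale L f + (0, 1))"
    using L fp by (force simp: feasible_def)
  moreover have "\<forall>g. feasible g \<longrightarrow> card (tight g) < Suc (card Q)"
    using \<open>finite Q\<close> by (auto simp: tight_def less_Suc_eq_le intro!: card_mono)
  ultimately obtain g where g: "feasible g"
    and gmax: "\<And>g'. feasible g' \<Longrightarrow> card (tight g') \<le> card (tight g)"
    using ex_has_greatest_nat[of feasible _ "\<lambda>g. card (tight g)"] by blast
  have "CARD('n) \<le> card (tight g)"
  proof (rule ccontr)
    assume "\<not> CARD('n) \<le> card (tight g)"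
    then have "card (insert p (tight g)) \<le> CARD('n)"
      using card_insert_le_m1[of "CARD('n)" "tight g" p] by fastforce
    then obtain u where u: "fst u \<noteq> 0" "\<forall>x\<in>insert p (tight g). ev u x = 0"
      using ex_affine_vanishing[of "insert p (tight g)"] finite_tight by auto
    obtain y where y: "y \<in> Q" "ev u y \<noteq> 0"
      using spanning[OF u(1)] u(2) by auto
    define v where "v = scale (sgn (ev u y)) u"
    have vy: "ev v y > 0"
      using y by (simp add: v_def sgn_if)
    have v0: "ev v x = 0" if "x \<in> insert p (tight g)" for x
      using u that by (auto simp: v_def)
    define E where "E = {x\<in>Q. ev v x > 0}"
    have E: "finite E" "E \<noteq> {}"
      using \<open>finite Q\<close> y vy by (auto simp: E_def)
    obtain z where z: "z \<in> E" and zmin: "\<And>x. x \<in> E \<Longrightarrow> - ev g z / ev v z \<le> - ev g x / ev v x"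
      using E arg_min_if_finite[of E "\<lambda>x. - ev g x / ev v x"] by (meson not_le)
    \<comment> \<open>The first point that becomes tight is \<open>z\<close>, after a step of length \<open>e\<close>.\<close>
    define e where "e = - ev g z / ev v z"
    have e: "e \<ge> 0"
      using g z by (auto simp: e_def feasible_def E_def divide_le_0_iff)
    define g' where "g' = g + scale e v"
    have "ev g' x \<le> 0" if "x \<in> Q" for x
    proof (cases "ev v x > 0")
      case True
      then have "e \<le> - ev g x / ev v x"
        using zmin that by (simp add: E_def e_def)
      with True show ?thesis by (simp add: g'_def field_simps)
    next
      case False
      then show ?thesis
        using g that e by (simp add: g'_def feasible_def add_nonpos_nonpos mult_nonneg_nonpos)
    qed
    moreover have "ev g' p = 1"
      using g v0 by (simp add: g'_def feasible_def)
    ultimately have "feasible g'" by (simp add: feasible_def)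
    moreover have "insert z (tight g) \<subseteq> tight g'"
      using z v0 by (auto simp: tight_def g'_def e_def E_def)
    moreover have "z \<notin> tight g"
      using z v0[of z] by (auto simp: E_def)
    ultimately show False
      using gmax[of g'] card_mono[OF finite_tight, of "insert z (tight g)" g'] finite_tight[of g]
      by auto
  qed
  then show ?thesis
    using g by (intro exI[of _ g]) (auto simp: feasible_def tight_def)
qed

section \<open>Building the polynomial layer by layer\<close>

lemma trop_root_iff:
  assumes "finite P"
  shows "trop_root P x \<longleftrightarrow>
    (\<exists>m\<in>P. \<exists>m'\<in>P. m \<noteq> m' \<and> ev m x = ev m' x \<and> (\<forall>l\<in>P. ev l x \<le> ev m x))"
proof -
  have "ev m x = trop_eval P x \<longleftrightarrow> (\<forall>l\<in>P. ev l x \<le> ev m x)" if "m \<in> P" for m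
    using assms that unfolding trop_eval_def
    by (metis (no_types, lifting) Max_eqI Max_ge finite_imageI image_eqI image_iff)
  then show ?thesis unfolding trop_root_def by (metis order_antisym)
qed

text \<open>
  The invariant of the construction. \<open>R\<close> consists of the points treated so far, and \<open>T\<close> is the next
  layer; maximality of \<open>M\<close> on \<open>T\<close> allows a new monomial that agrees with \<open>M\<close> on \<open>T\<close> to produce roots
  there.
\<close>

definition extendable :: "nat \<Rightarrow> (rat ^ 'n::finite) set \<Rightarrow> (rat ^ 'n) set \<Rightarrow> bool" where
  "extendable k R T \<longleftrightarrow> (\<exists>P. \<exists>M\<in>P. trop_poly P \<and> card P \<le> k \<and>
    (\<forall>x\<in>R. trop_root P x) \<and> (\<forall>x\<in>T. \<forall>m\<in>P. ev m x \<le> ev M x))"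

lemma extendable_empty: "k \<ge> 1 \<Longrightarrow> extendable k {} T"
  unfolding extendable_def by (intro exI[of _ "{(0, 0)}"]) (simp add: trop_poly_def)

text \<open>
  The zero function and \<open>u\<close> have distinct exponent vectors but agree on the whole
  hyperplane. Thus points in degenerate position, which admit no facets with \<open>n\<close> points, are cheap.
\<close>

lemma extendable_hyperplane:
  assumes "k \<ge> 2" and u: "fst u \<noteq> 0" "\<And>x. x \<in> R \<union> T \<Longrightarrow> ev u x = 0"
  shows "extendable k R T"
proof -
  have "(0, 0) \<noteq> u" using u by auto
  moreover have "trop_poly {(0, 0), u}"
    using u by (auto simp: trop_poly_def inj_on_def)
  moreover have "trop_root {(0, 0), u} x" if "x \<in> R" for x
    using u that \<open>(0, 0) \<noteq> u\<close> by (subst trop_root_iff) auto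
  ultimately show ?thesis
    using assms unfolding extendable_def
    by (intro exI[of _ "{(0, 0), u}"] bexI[of _ u]) auto
qed

text \<open>
  The new monomial is \<open>N = M + l * g\<close>. For large \<open>l\<close> it exceeds the other monomials on \<open>T\<close>, where
  \<open>g\<close> is positive. Every point of \<open>A\<close> is a root because \<open>M\<close> and \<open>N\<close> tie there at the maximum, and
  on \<open>R\<close> the old maximum persists because of \<open>N \<le> M\<close>.
\<close>

lemma extend_outwards:
  fixes R A T :: "(rat ^ 'n::finite) set"
  assumes ext: "extendable k R A" and "finite T" and "fst g \<noteq> 0"
    and gA: "\<And>x. x \<in> A \<Longrightarrow> ev g x = 0" and gR: "\<And>x. x \<in> R \<Longrightarrow> ev g x \<le> 0"
    and gT: "\<And>x. x \<in> T \<Longrightarrow> ev g x > 0"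
  shows "extendable (Suc k) (R \<union> A) T"
proof -
  obtain P M where P: "trop_poly P" "M \<in> P" "card P \<le> k"
    and rootsR: "\<And>x. x \<in> R \<Longrightarrow> trop_root P x"
    and topA: "\<And>x m. x \<in> A \<Longrightarrow> m \<in> P \<Longrightarrow> ev m x \<le> ev M x"
    using ext unfolding extendable_def by blast
  have finP: "finite P" using P by (simp add: trop_poly_def)
  obtain i where i: "fst g $ i \<noteq> 0"
    using \<open>fst g \<noteq> 0\<close> by (auto simp: vec_eq_iff)
  have "\<exists>L. \<forall>l\<ge>L. \<forall>y\<in>P \<times> T. ev (fst y) (snd y) - ev M (snd y) < l * ev g (snd y)"
    by (rule ex_multiple_dominating) (use finP \<open>finite T\<close> gT in auto)
  then obtain L where L: "\<And>l m x. l \<ge> L \<Longrightarrow> m \<in> P \<Longrightarrow> x \<in> T \<Longrightarrow> ev m x - ev M x < l * ev g x"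
    by fastforce
  \<comment> \<open>Finitely many values of \<open>l\<close> would repeat an exponent vector already in \<open>P\<close>.\<close>
  let ?bad = "(\<lambda>m. (fst m $ i - fst M $ i) / fst g $ i) ` P"
  have "\<not> {max L 0..} \<subseteq> ?bad"
    using infinite_Ici[of "max L 0"] finP by (meson finite_imageI finite_subset)
  then obtain l where l: "l \<ge> max L 0" "l \<notin> ?bad"
    unfolding subset_iff atLeast_iff by blast
  define N where "N = M + scale l g"
  have evN: "ev N x = ev M x + l * ev g x" for x
    by (simp add: N_def)
  have new: "fst N \<noteq> fst m" if m: "m \<in> P" for m
  proof
    assume "fst N = fst m"
    then have "fst m $ i - fst M $ i = l * fst g $ i"
      by (simp add: N_def scale_def flip: \<open>fst N = fst m\<close>)
    then have "l = (fst m $ i - fst M $ i) / fst g $ i" using i by simp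
    with l(2) m show False by blast
  qed
  have "trop_poly (insert N P)"
  proof -
    have "fst N \<notin> fst ` P" using new by (metis imageE)
    then show ?thesis using P(1) unfolding trop_poly_def by (meson finite.insertI inj_on_insert image_mono Diff_subset subsetD)
  qed
  moreover have "card (insert N P) \<le> Suc k"
    using P(3) finP by (simp add: card_insert_if)
  moreover have "trop_root (insert N P) x" if x: "x \<in> R" for x
  proof -
    obtain m m' where m: "m \<in> P" "m' \<in> P" "m \<noteq> m'" "ev m x = ev m' x" "\<forall>k\<in>P. ev k x \<le> ev m x"
      using rootsR[OF x] unfolding trop_root_iff[OF finP] by blast
    have "ev N x \<le> ev M x"
      using gR[OF x] l(1) by (simp add: evN mult_nonneg_nonpos)
    also have "\<dots> \<le> ev m x" using m P by blast
    finally have "\<forall>k\<in>insert N P. ev k x \<le> ev m x" using m(5) by blast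
    with m show ?thesis
      unfolding trop_root_iff[OF finite.insertI[OF finP]] by blast
  qed
  moreover have "trop_root (insert N P) x" if x: "x \<in> A" for x
  proof -
    have "M \<noteq> N" using new P by blast
    moreover have "ev M x = ev N x" using gA[OF x] by (simp add: evN)
    moreover have "\<forall>k\<in>insert N P. ev k x \<le> ev M x"
      using topA[OF x] calculation by simp
    ultimately show ?thesis
      unfolding trop_root_iff[OF finite.insertI[OF finP]] using P(2) by blast
  qed
  moreover have "ev m x \<le> ev N x" if "x \<in> T" "m \<in> insert N P" for x m
    using that L[of l m x] l(1) by (auto simp: evN)
  ultimately show ?thesis
    unfolding extendable_def by (intro exI[of _ "insert N P"] bexI[of _ N]) blast+
qed

text \<open>
  One facet layer, taken off \<open>Q\<close> as seen from the single point \<open>p\<close>. The premise \<open>inner\<close> provides the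
  polynomial for the points inside the facet.
\<close>

lemma extendable_by_facet:
  fixes Q :: "(rat ^ 'n::finite) set"
  assumes "finite Q" and fp: "ev f p = 0" and fQ: "\<And>x. x \<in> Q \<Longrightarrow> ev f x < 0" and "k \<ge> 1"
    and inner: "\<And>A h. \<lbrakk>A \<subseteq> Q; A \<noteq> {}; card (Q - A) + CARD('n) \<le> card Q;
      \<And>x. x \<in> A \<Longrightarrow> ev h x = 0; \<And>x. x \<in> Q - A \<Longrightarrow> ev h x < 0\<rbrakk> \<Longrightarrow> extendable k (Q - A) A"
  shows "extendable (Suc k) Q {p}"
proof (cases "\<exists>u. fst u \<noteq> 0 \<and> (\<forall>x\<in>insert p Q. ev u x = 0)")
  case True
  then obtain u where "fst u \<noteq> 0" "\<forall>x\<in>insert p Q. ev u x = 0" by blast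
  then show ?thesis
    using \<open>k \<ge> 1\<close> by (intro extendable_hyperplane[of "Suc k" u]) auto
next
  case False
  then obtain h where hp: "ev h p > 0" and hQ: "\<And>x. x \<in> Q \<Longrightarrow> ev h x \<le> 0"
    and many: "CARD('n) \<le> card {x\<in>Q. ev h x = 0}"
    using visible_facet[OF \<open>finite Q\<close> fp fQ] by blast
  define A where "A = {x\<in>Q. ev h x = 0}"
  have "A \<subseteq> Q" and hA: "\<And>x. x \<in> A \<Longrightarrow> ev h x = 0"
    by (auto simp: A_def)
  have hR: "\<And>x. x \<in> Q - A \<Longrightarrow> ev h x < 0"
    using hQ by (force simp: A_def)
  have "CARD('n) \<le> card A" using many by (simp add: A_def)
  then have "A \<noteq> {}"
    using zero_less_card_finite[where 'a = 'n] by (metis card.empty not_le)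
  have "card A \<le> card Q"
    using \<open>finite Q\<close> \<open>A \<subseteq> Q\<close> by (rule card_mono)
  then have "card (Q - A) + CARD('n) \<le> card Q"
    using \<open>CARD('n) \<le> card A\<close> card_Diff_subset[of A Q] \<open>finite Q\<close> \<open>A \<subseteq> Q\<close>
      finite_subset[of A Q] by linarith
  then have "extendable k (Q - A) A"
    using inner \<open>A \<subseteq> Q\<close> \<open>A \<noteq> {}\<close> hA hR by blast
  moreover have "fst h \<noteq> 0"
    using hp \<open>A \<noteq> {}\<close> hA by (metis ev_constant all_not_in_conv less_irrefl)
  ultimately have "extendable (Suc k) ((Q - A) \<union> A) {p}"
    by (rule extend_outwards[OF _ finite.insertI[OF finite.emptyI]])
       (use hA hR hp in \<open>auto simp: less_imp_le\<close>)
  then show ?thesis using \<open>A \<subseteq> Q\<close> by (simp add: Un_absorb2)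
qed

text \<open>
  Two layers at a time, a vertex and then a facet visible from it, cost two monomials and remove at
  least \<open>n + 1\<close> points. The layer \<open>T\<close> outside must be nonempty, since this forces the affine function
  that defines the vertex layer to be nonconstant.
\<close>

lemma extendable_odd:
  fixes R T :: "(rat ^ 'n::finite) set"
  assumes "finite R" "finite T" "T \<noteq> {}" and "card R \<le> j * (CARD('n) + 1)"
    and "\<And>x. x \<in> T \<Longrightarrow> ev g x = 0" and "\<And>x. x \<in> R \<Longrightarrow> ev g x < 0"
  shows "extendable (2 * j + 1) R T"
  using assms
proof (induction j arbitrary: R T g)
  case 0
  then show ?case by (simp add: extendable_empty)
next
  case (Suc j)
  show ?case
  proof (cases "R = {}")
    case True
    then show ?thesis by (simp add: extendable_empty)
  next
    case False
    obtain p f where p: "p \<in> R" and fp: "ev f p = 0"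
      and fR: "\<And>x. x \<in> R - {p} \<Longrightarrow> ev f x < 0" and fT: "\<And>x. x \<in> T \<Longrightarrow> ev f x > 0"
      using peel_vertex[OF Suc.prems(1,2) False Suc.prems(5,6)] by blast
    have "card (R - {p}) + 1 = card R"
      using p Suc.prems(1) by (metis Suc_eq_plus1 card_Suc_Diff1)
    then have card_Q: "card (R - {p}) \<le> j * (CARD('n) + 1) + CARD('n)"
      using Suc.prems(4) by simp
    have "extendable (Suc (2 * j + 1)) (R - {p}) {p}"
    proof (rule extendable_by_facet[OF _ fp fR])
      fix A h
      assume A: "A \<subseteq> R - {p}" "A \<noteq> {}" "card (R - {p} - A) + CARD('n) \<le> card (R - {p})"
        and h: "\<And>x. x \<in> A \<Longrightarrow> ev h x = 0" "\<And>x. x \<in> R - {p} - A \<Longrightarrow> ev h x < 0"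
      have "finite A" using A(1) Suc.prems(1) by (meson finite_Diff finite_subset)
      moreover have "card (R - {p} - A) \<le> j * (CARD('n) + 1)"
        using A(3) card_Q by linarith
      ultimately show "extendable (2 * j + 1) (R - {p} - A) A"
        using Suc.IH[of "R - {p} - A" A h] A(2) h Suc.prems(1) by blast
    qed (use Suc.prems(1) in auto)
    moreover have "fst f \<noteq> 0"
      using fp fT Suc.prems(3) by (metis ev_constant all_not_in_conv less_irrefl)
    ultimately have "extendable (Suc (Suc (2 * j + 1))) ((R - {p}) \<union> {p}) T"
      by (rule extend_outwards[OF _ Suc.prems(2)]) (use fp fR fT in \<open>auto simp: less_imp_le\<close>)
    then show ?thesis using p by (simp add: insert_absorb)
  qed
qed

text \<open>
  For odd \<open>c\<close>, half a period of the alternation is left over. Spending it on an outermost facet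
  removes at least \<open>n\<close> points, and \<open>n \<ge> (n + 1) / 2\<close>.
\<close>

lemma ex_trop_poly_with_roots:
  fixes S :: "(rat ^ 'n::finite) set"
  assumes "finite S" and "2 * card S \<le> c * (CARD('n) + 1)"
  shows "\<exists>P. trop_poly P \<and> P \<noteq> {} \<and> card P \<le> c + 1 \<and> (\<forall>x\<in>S. trop_root P x)"
proof -
  obtain p f where fp: "ev f p = 0" and fS: "\<And>x. x \<in> S \<Longrightarrow> ev f x < 0"
    using ex_point_beyond[OF \<open>finite S\<close>] by blast
  have "extendable (c + 1) S {p}"
  proof (cases "even c")
    case True
    then obtain j where j: "c = 2 * j" by blast
    then have "card S \<le> j * (CARD('n) + 1)" using assms by simp
    then show ?thesis
      unfolding j using fp fS \<open>finite S\<close> by (intro extendable_odd[of S "{p}" j f]) auto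
  next
    case False
    then obtain j where j: "c = 2 * j + 1" by (auto elim: oddE)
    have "extendable (Suc (2 * j + 1)) S {p}"
    proof (rule extendable_by_facet[OF \<open>finite S\<close> fp fS])
      fix A h
      assume A: "A \<subseteq> S" "A \<noteq> {}" "card (S - A) + CARD('n) \<le> card S"
        and h: "\<And>x. x \<in> A \<Longrightarrow> ev h x = 0" "\<And>x. x \<in> S - A \<Longrightarrow> ev h x < 0"
      have "2 * card S \<le> 2 * (j * (CARD('n) + 1)) + (CARD('n) + 1)"
        using assms(2) j by (simp add: algebra_simps)
      then have "card (S - A) \<le> j * (CARD('n) + 1)"
        using A(3) zero_less_card_finite[where 'a = 'n] by linarith
      moreover have "finite A" using A(1) \<open>finite S\<close> by (rule finite_subset)
      ultimately show "extendable (2 * j + 1) (S - A) A"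
        using extendable_odd[of "S - A" A j h] A(2) h \<open>finite S\<close> by blast
    qed auto
    then show ?thesis by (simp add: j)
  qed
  then obtain P M where "M \<in> P" "trop_poly P" "card P \<le> c + 1" "\<forall>x\<in>S. trop_root P x"
    unfolding extendable_def by blast
  then show ?thesis by (intro exI[of _ P]) auto
qed

section \<open>Testing sets on the moment curve\<close>

text \<open>
  Along the moment curve, an affine function is a polynomial in the parameter whose coefficients are
  those of the function, so it has a bounded number of zeros unless it is constant.
\<close>

lemma affine_zeros_on_curve:
  obtains curve :: "rat \<Rightarrow> rat ^ 'n::finite" and d :: nat
  where "\<And>u. fst u \<noteq> 0 \<Longrightarrow> finite {t. ev u (curve t) = 0} \<and> card {t. ev u (curve t) = 0} \<le> d"
proof -
  obtain e :: "'n \<Rightarrow> nat" where e: "inj e"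
    using finite_imp_inj_to_nat_seg[of "UNIV :: 'n set"] by auto
  define curve :: "rat \<Rightarrow> rat ^ 'n" where "curve t = (\<chi> i. t ^ Suc (e i))" for t
  have "finite {t. ev u (curve t) = 0} \<and> card {t. ev u (curve t) = 0} \<le> Suc (Max (range e))"
    if u: "fst u \<noteq> 0" for u
  proof -
    define q where "q = [:snd u:] + (\<Sum>i\<in>UNIV. monom (fst u $ i) (Suc (e i)))"
    have q: "poly q t = ev u (curve t)" for t
      by (simp add: q_def poly_sum poly_monom curve_def trop_monomial_eval_def)
    obtain i where i: "fst u $ i \<noteq> 0"
      using u by (auto simp: vec_eq_iff)
    have "coeff q (Suc (e i)) = (\<Sum>j\<in>UNIV. if j = i then fst u $ j else 0)"
      using e by (auto simp: q_def coeff_sum inj_eq intro!: sum.cong)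
    then have "q \<noteq> 0" using i by auto
    have "degree q \<le> Suc (Max (range e))"
      unfolding q_def
      by (intro degree_add_le degree_sum_le order_trans[OF degree_monom_le]) auto
    then show ?thesis
      using card_poly_roots_bound[OF \<open>q \<noteq> 0\<close>] poly_roots_finite[OF \<open>q \<noteq> 0\<close>]
      unfolding q by linarith
  qed
  then show ?thesis by (rule that)
qed

text \<open>
  Every root of a polynomial is a zero of the difference of two of its monomials. There are at most
  \<open>k\<^sup>2\<close> such differences, all nonconstant, and each vanishes at no more than \<open>d\<close> points of the curve.
\<close>

lemma universal_testing_set_exists:
  "\<exists>S :: (rat ^ 'n::finite) set. universal_testing_set k S"
proof -
  obtain curve :: "rat \<Rightarrow> rat ^ 'n" and d where
    d: "\<And>u. fst u \<noteq> 0 \<Longrightarrow> finite {t. ev u (curve t) = 0} \<and> card {t. ev u (curve t) = 0} \<le> d"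
    using affine_zeros_on_curve by blast
  define I where "I = rat_of_nat ` {..k * k * d}"
  have cardI: "card I = k * k * d + 1"
    by (simp add: I_def card_image inj_on_def)
  have "\<exists>a\<in>curve ` I. \<not> trop_root P a" if P: "trop_poly P" "card P \<le> k" for P
  proof (rule ccontr)
    assume "\<not> ?thesis"
    then have root: "trop_root P (curve t)" if "t \<in> I" for t
      using that by blast
    have finP: "finite P" and inj: "inj_on fst P" using P by (auto simp: trop_poly_def)
    define pairs where "pairs = {(m, m') \<in> P \<times> P. m \<noteq> m'}"
    define Z where "Z = (\<lambda>(m, m'). {t. ev (m + scale (-1) m') (curve t) = 0})"
    have Z: "finite (Z mm) \<and> card (Z mm) \<le> d" if mm_in: "mm \<in> pairs" for mm
    proof -
      obtain m m' where mm: "mm = (m, m')" "m \<in> P" "m' \<in> P" "m \<noteq> m'"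
        using mm_in unfolding pairs_def by blast
      then have "fst (m + scale (-1) m') \<noteq> 0"
        using inj by (auto simp: scale_def inj_on_def vec_eq_iff)
      from d[OF this] show ?thesis by (simp add: Z_def mm)
    qed
    have finpairs: "finite pairs"
      using finP by (auto simp: pairs_def intro: finite_subset[of _ "P \<times> P"])
    have "card pairs \<le> card (P \<times> P)"
      using finP by (intro card_mono) (auto simp: pairs_def)
    also have "\<dots> \<le> k * k"
      using P by (simp add: card_cartesian_product mult_le_mono)
    finally have cardpairs: "card pairs \<le> k * k" .
    have "I \<subseteq> (\<Union>mm\<in>pairs. Z mm)"
    proof
      fix t assume "t \<in> I"
      then obtain m m' where "m \<in> P" "m' \<in> P" "m \<noteq> m'" "ev m (curve t) = ev m' (curve t)"
        using root[of t] unfolding trop_root_iff[OF finP] by blast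
      then show "t \<in> (\<Union>mm\<in>pairs. Z mm)"
        by (intro UN_I[of "(m, m')"]) (auto simp: pairs_def Z_def)
    qed
    then have "card I \<le> card (\<Union>mm\<in>pairs. Z mm)"
      using Z finpairs by (intro card_mono) auto
    also have "\<dots> \<le> (\<Sum>mm\<in>pairs. card (Z mm))"
      by (rule card_UN_le[OF finpairs])
    also have "\<dots> \<le> card pairs * d"
      using Z by (intro sum_bounded_above[of pairs "\<lambda>mm. card (Z mm)" d, simplified]) auto
    also have "\<dots> \<le> k * k * d"
      using cardpairs by simp
    finally show False by (simp add: cardI)
  qed
  then have "universal_testing_set k (curve ` I)"
    by (simp add: universal_testing_set_def I_def)
  then show ?thesis by blast
qed

section \<open>The two bounds\<close>

theorem theorem10:
  shows "(\<forall>s::nat. int (min_monomials TYPE('n::finite) s)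
            \<le> \<lceil>2 * real s / (real CARD('n) + 1)\<rceil> + 1)
       \<and> (\<forall>k::nat. k \<ge> 1 \<longrightarrow>
            real (min_testing_set_size TYPE('n) k) \<ge> ((real k - 1) * (real CARD('n) + 1) + 1) / 2)"
proof (intro conjI allI impI)
  fix s :: nat
  define c where "c = nat \<lceil>2 * real s / (real CARD('n) + 1)\<rceil>"
  have c: "int c = \<lceil>2 * real s / (real CARD('n) + 1)\<rceil>"
    unfolding c_def by (intro nat_0_le) (simp add: order_less_le_trans[of "-1" 0])
  have "2 * real s / (real CARD('n) + 1) \<le> real c"
    by (metis c le_of_int_ceiling of_int_of_nat_eq)
  then have "2 * real s \<le> real c * (real CARD('n) + 1)"
    by (simp add: divide_le_eq)
  then have "real (2 * s) \<le> real (c * (CARD('n) + 1))" by (simp add: algebra_simps)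
  then have "2 * s \<le> c * (CARD('n) + 1)" by (rule of_nat_le_iff[THEN iffD1])
  then have "min_monomials TYPE('n) s \<le> c + 1"
    unfolding min_monomials_def by (intro Least_le allI impI ex_trop_poly_with_roots) auto
  then show "int (min_monomials TYPE('n) s) \<le> \<lceil>2 * real s / (real CARD('n) + 1)\<rceil> + 1"
    unfolding c[symmetric] by simp
next
  fix k :: nat
  assume "k \<ge> 1"
  obtain S :: "(rat ^ 'n) set"
    where S: "universal_testing_set k S" "card S = min_testing_set_size TYPE('n) k"
    using LeastI_ex[of "\<lambda>s. \<exists>S :: (rat ^ 'n) set. universal_testing_set k S \<and> card S = s"]
      universal_testing_set_exists unfolding min_testing_set_size_def by blast
  have "\<not> 2 * card S \<le> (k - 1) * (CARD('n) + 1)"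
  proof
    assume "2 * card S \<le> (k - 1) * (CARD('n) + 1)"
    from ex_trop_poly_with_roots[OF _ this] S(1) \<open>k \<ge> 1\<close> show False
      by (auto simp: universal_testing_set_def)
  qed
  then have "(k - 1) * (CARD('n) + 1) + 1 \<le> 2 * card S" by simp
  then have "real ((k - 1) * (CARD('n) + 1) + 1) \<le> real (2 * card S)" by (rule of_nat_mono)
  then show "real (min_testing_set_size TYPE('n) k) \<ge> ((real k - 1) * (real CARD('n) + 1) + 1) / 2"
    using \<open>k \<ge> 1\<close> unfolding S(2) of_nat_add of_nat_mult by (simp add: of_nat_diff)
qed

end
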